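(* Let $n\ge1$ and $\gamma(t)=(t,t^2,\dots,t^n,t^{n+1}):[0,1]\to\mathbb{R}^{n+1}$, $\overline{\gamma}(t)=(t,\dots,t^n)$. If $x=(x_1,\dots,x_n)\in\mathrm{int}(\mathrm{conv}(\overline{\gamma}([0,1])))$, then $B^{\sup}(x)$ and $B^{\inf}(x)$ are the unique solutions $x_{n+1}$ of the equations $K_{n+1}=0$ and $S_{n+1}=0$, respectively, where $K_{n+1}$ and $S_{n+1}$ are the determinants in $x_1,\dots,x_{n+1}$ defined in the context.
   Context: $\mathrm{conv}$ is convex hull and $\mathrm{int}$ topological interior in $\mathbb{R}^n$. With $x_0:=1$, define $$S_{2k}=\det(x_{i+j})_{i,j=0}^{k},\qquad S_{2k+1}=\det(x_{i+j+1})_{i,j=0}^{k},$$ $$K_{2k}=\det(x_{i+j-1}-x_{i+j})_{i,j=1}^{k},\qquad K_{2k+1}=\det(x_{i+j}-x_{i+j+1})_{i,j=0}^{k}.$$ With $a=0$, $b=1$, set $$\Delta_c^k=\{(r_1,\dots,r_k)\in\mathbb{R}^k: r_j\ge0,\ r_1+\dots+r_k\le1\},\qquad \Delta_*^k=\{(y_1,\dots,y_k)\in\mathbb{R}^k: 0\le y_1\le\dots\le y_k\le 1\}$$ ($\Delta_c^0,\Delta_*^0$ are single points; empty sums are $0$). Let $\gamma_{n+1}(t)=t^{n+1}$. The functions $B^{\sup},B^{\inf}:\mathrm{conv}(\overline{\gamma}([0,1]))\to\mathbb{R}$ are defined as follows (these formulas define functions unambiguously on all of $\mathrm{conv}(\overline{\gamma}([0,1]))$).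 If $n=2\ell$: for all $(\lambda_1,\dots,\lambda_\ell,y_1,\dots,y_\ell)\in\Delta_c^\ell\times\Delta_*^\ell$, $$B^{\sup}\Big(\sum_{j=1}^\ell\lambda_j\overline{\gamma}(y_j)+\big(1-\sum_{j=1}^\ell\lambda_j\big)\overline{\gamma}(1)\Big)=\sum_{j=1}^\ell\lambda_j\gamma_{n+1}(y_j)+\big(1-\sum_{j=1}^\ell\lambda_j\big)\gamma_{n+1}(1),$$ $$B^{\inf}\Big(\big(1-\sum_{j=1}^\ell\lambda_j\big)\overline{\gamma}(0)+\sum_{j=1}^\ell\lambda_j\overline{\gamma}(y_j)\Big)=\big(1-\sum_{j=1}^\ell\lambda_j\big)\gamma_{n+1}(0)+\sum_{j=1}^\ell\lambda_j\gamma_{n+1}(y_j).$$ If $n=2\ell-1$: for all $(\beta_1,\dots,\beta_\ell,y_2,\dots,y_\ell)\in\Delta_c^\ell\times\Delta_*^{\ell-1}$, $$B^{\sup}\Big(\big(1-\sum_{j=1}^\ell\beta_j\big)\overline{\gamma}(0)+\sum_{j=2}^\ell\beta_j\overline{\gamma}(y_j)+\beta_1\overline{\gamma}(1)\Big)=\big(1-\sum_{j=1}^\ell\beta_j\big)\gamma_{n+1}(0)+\sum_{j=2}^\ell\beta_j\gamma_{n+1}(y_j)+\beta_1\gamma_{n+1}(1),$$ and for all $(\beta_2,\dots,\beta_\ell,y_1,\dots,y_\ell)\in\Delta_c^{\ell-1}\times\Delta_*^{\ell}$, $$B^{\inf}\Big(\big(1-\sum_{j=2}^\ell\beta_j\big)\overline{\gamma}(y_1)+\sum_{j=2}^\ell\beta_j\overline{\gamma}(y_j)\Big)=\big(1-\sum_{j=2}^\ell\beta_j\big)\gamma_{n+1}(y_1)+\sum_{j=2}^\ell\beta_j\gamma_{n+1}(y_j).$$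 *)

theory Defs
  imports "HOL-Analysis.Analysis" "Jordan_Normal_Form.Determinant"
begin

hide_const (open) Matrix.mat Determinants.det
no_notation Matrix.vec_index (infixl "$" 100)

text \<open>
  The space \<open>\<real>\<^sup>n\<close> is \<open>real ^ 'n\<close> with \<open>n = CARD('n)\<close>. Coordinates are numbered \<open>1, \<dots>, n\<close> by an
  arbitrary bijection \<open>e\<close> from \<open>'n\<close> onto \<open>{1..CARD('n)}\<close>, so that the point \<open>(x\<^sub>1, \<dots>, x\<^sub>n)\<close> has
  \<open>x\<^sub>k = x $ inv_into UNIV e k\<close>. The determinants, whose sizes depend on \<open>n\<close>, use the matrices of
  \<open>Jordan_Normal_Form\<close>, which are indexed from \<open>0\<close>, and take a point as a sequence
  \<open>x :: nat \<Rightarrow> real\<close> with \<open>x 0 = 1\<close>.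
\<close>

definition hankel_S :: "nat \<Rightarrow> (nat \<Rightarrow> real) \<Rightarrow> real" where
  "hankel_S m x =
     (let k = m div 2 in
      if even m
      then Determinant.det (Matrix.mat (k + 1) (k + 1) (\<lambda>(i, j). x (i + j)))
      else Determinant.det (Matrix.mat (k + 1) (k + 1) (\<lambda>(i, j). x (i + j + 1))))"

text \<open>
  In the even case of \<open>K\<close> the row and column indices of \<open>x\<^sub>i\<^sub>+\<^sub>j\<^sub>-\<^sub>1 - x\<^sub>i\<^sub>+\<^sub>j\<close> run from \<open>1\<close> to \<open>k\<close>; both
  are shifted down by one below.
\<close>

definition hankel_K :: "nat \<Rightarrow> (nat \<Rightarrow> real) \<Rightarrow> real" where
  "hankel_K m x =
     (let k = m div 2 in
      if even m
      then Determinant.det (Matrix.mat k k (\<lambda>(i, j). x (i + j + 1) - x (i + j + 2)))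
      else Determinant.det (Matrix.mat (k + 1) (k + 1) (\<lambda>(i, j). x (i + j) - x (i + j + 1))))"

text \<open>The sequence \<open>(1, x\<^sub>1, \<dots>, x\<^sub>n, v)\<close>; entries beyond index \<open>n + 1\<close> are never used.\<close>

definition extend_point :: "('n::finite \<Rightarrow> nat) \<Rightarrow> real ^ 'n \<Rightarrow> real \<Rightarrow> nat \<Rightarrow> real" where
  "extend_point e x v k =
     (if k = 0 then 1 else if k \<le> CARD('n) then x $ inv_into UNIV e k else v)"

definition gamma_bar :: "('n::finite \<Rightarrow> nat) \<Rightarrow> real \<Rightarrow> real ^ 'n" where
  "gamma_bar e t = (\<chi> i. t ^ e i)"

definition gamma_last :: "'n::finite itself \<Rightarrow> real \<Rightarrow> real" where
  "gamma_last _ t = t ^ (CARD('n) + 1)"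

text \<open>
  The simplices \<open>\<Delta>\<^sub>c\<^sup>k\<close> and \<open>\<Delta>\<^sub>*\<^sup>k\<close>, with coordinates labelled by a set \<open>I\<close> of \<open>k\<close> natural numbers
  (\<open>{1..l}\<close> or \<open>{2..l}\<close>). Values of the functions outside \<open>I\<close> are irrelevant.
\<close>

definition simplex_c :: "nat set \<Rightarrow> (nat \<Rightarrow> real) set" where
  "simplex_c I = {r. (\<forall>j\<in>I. 0 \<le> r j) \<and> (\<Sum>j\<in>I. r j) \<le> 1}"

definition simplex_ord :: "nat set \<Rightarrow> (nat \<Rightarrow> real) set" where
  "simplex_ord I = {y. mono_on I y \<and> (\<forall>j\<in>I. 0 \<le> y j \<and> y j \<le> 1)}"

text \<open>
  \<open>B_sup_graph e x v\<close> and \<open>B_inf_graph e x v\<close> say that the defining formulas prescribe the value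
  \<open>v\<close> at the point \<open>x\<close>.
\<close>

inductive B_sup_graph :: "('n::finite \<Rightarrow> nat) \<Rightarrow> real ^ 'n \<Rightarrow> real \<Rightarrow> bool"
  for e :: "'n::finite \<Rightarrow> nat" where
  even: "B_sup_graph e
      ((\<Sum>j=1..l. lam j *\<^sub>R gamma_bar e (y j)) + (1 - (\<Sum>j=1..l. lam j)) *\<^sub>R gamma_bar e 1)
      ((\<Sum>j=1..l. lam j * gamma_last TYPE('n) (y j))
        + (1 - (\<Sum>j=1..l. lam j)) * gamma_last TYPE('n) 1)"
    if "CARD('n) = 2 * l" "lam \<in> simplex_c {1..l}" "y \<in> simplex_ord {1..l}"
| odd: "B_sup_graph e
      ((1 - (\<Sum>j=1..l. b j)) *\<^sub>R gamma_bar e 0 + (\<Sum>j=2..l. b j *\<^sub>R gamma_bar e (y j))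
        + b 1 *\<^sub>R gamma_bar e 1)
      ((1 - (\<Sum>j=1..l. b j)) * gamma_last TYPE('n) 0
        + (\<Sum>j=2..l. b j * gamma_last TYPE('n) (y j)) + b 1 * gamma_last TYPE('n) 1)"
    if "CARD('n) + 1 = 2 * l" "b \<in> simplex_c {1..l}" "y \<in> simplex_ord {2..l}"

inductive B_inf_graph :: "('n::finite \<Rightarrow> nat) \<Rightarrow> real ^ 'n \<Rightarrow> real \<Rightarrow> bool"
  for e :: "'n::finite \<Rightarrow> nat" where
  even: "B_inf_graph e
      ((1 - (\<Sum>j=1..l. lam j)) *\<^sub>R gamma_bar e 0 + (\<Sum>j=1..l. lam j *\<^sub>R gamma_bar e (y j)))
      ((1 - (\<Sum>j=1..l. lam j)) * gamma_last TYPE('n) 0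
        + (\<Sum>j=1..l. lam j * gamma_last TYPE('n) (y j)))"
    if "CARD('n) = 2 * l" "lam \<in> simplex_c {1..l}" "y \<in> simplex_ord {1..l}"
| odd: "B_inf_graph e
      ((1 - (\<Sum>j=2..l. b j)) *\<^sub>R gamma_bar e (y 1) + (\<Sum>j=2..l. b j *\<^sub>R gamma_bar e (y j)))
      ((1 - (\<Sum>j=2..l. b j)) * gamma_last TYPE('n) (y 1)
        + (\<Sum>j=2..l. b j * gamma_last TYPE('n) (y j)))"
    if "CARD('n) + 1 = 2 * l" "b \<in> simplex_c {2..l}" "y \<in> simplex_ord {1..l}"

text \<open>
  These are meant as functions on \<open>convex hull (gamma_bar e ` {0..1})\<close>, where the formulas
  prescribe exactly one value; elsewhere the values are unspecified.
\<close>

definition B_sup :: "('n::finite \<Rightarrow> nat) \<Rightarrow> real ^ 'n \<Rightarrow> real" where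
  "B_sup e x = (THE v. B_sup_graph e x v)"

definition B_inf :: "('n::finite \<Rightarrow> nat) \<Rightarrow> real ^ 'n \<Rightarrow> real" where
  "B_inf e x = (THE v. B_inf_graph e x v)"

end

theory Submission
  imports Defs
begin

text \<open>
  Put \<open>n = CARD('n)\<close>. A sequence \<open>(1, x\<^sub>1, \<dots>, x\<^sub>n, v)\<close> defines a linear functional \<open>L\<^sub>v\<close> on polynomials of
  degree at most \<open>n + 1\<close> by \<open>X\<^sup>k \<mapsto> x\<^sub>k\<close>. The determinants \<open>S\<^sub>n\<^sub>+\<^sub>1\<close> and \<open>K\<^sub>n\<^sub>+\<^sub>1\<close> are Gram determinants of the
  forms \<open>(p, r) \<mapsto> L\<^sub>v(w p r)\<close> on polynomials of degree below \<open>N\<close>, where \<open>w\<close> is \<open>1\<close> or \<open>X\<close> for \<open>S\<close> and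
  \<open>X (1 - X)\<close> or \<open>1 - X\<close> for \<open>K\<close>, depending on the parity of \<open>n\<close>, and \<open>deg w + 2 (N - 1) = n + 1\<close>. So a
  determinant vanishes iff some polynomial \<open>p \<noteq> 0\<close> of degree below \<open>N\<close> is orthogonal to all the
  others (\<open>det_moment_matrix_eq_0_iff\<close>). Three facts give the theorem.

  At most one \<open>v\<close> is a root (\<open>det_moment_matrix_zero_unique\<close>). For \<open>x\<close> in the interior of the moment
  space, \<open>L\<^sub>v\<close> is positive on nonzero polynomials of degree at most \<open>n\<close> that are nonnegative on
  \<open>[0, 1]\<close> (\<open>riesz_pos\<close>). Hence orthogonal polynomials have full degree \<open>N - 1\<close>, and comparison of two
  of them, for \<open>v\<close> and \<open>v'\<close>, yields \<open>v = v'\<close>.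

  Every value prescribed by the formulas for \<open>B\<^sup>s\<^sup>u\<^sup>p\<close> or \<open>B\<^sup>i\<^sup>n\<^sup>f\<close> is a root
  (\<open>hankel_K_eq_0_if_B_sup_graph\<close>, \<open>hankel_S_eq_0_if_B_inf_graph\<close>). The formulas write \<open>L\<^sub>v\<close> as
  integration against a measure with few atoms: besides the zeros of \<open>w\<close>, there are fewer than \<open>N\<close>,
  and the polynomial with these roots is orthogonal to everything.

  The formulas do prescribe a value at \<open>x\<close> (\<open>B_sup_graph_exists\<close>, \<open>B_inf_graph_exists\<close>). Take the
  largest or smallest \<open>v\<close> with \<open>(x, v)\<close> in the convex hull of the curve \<open>\<gamma>\<close> in \<open>\<real>\<^sup>n\<^sup>+\<^sup>1\<close>. A supporting
  hyperplane at \<open>(x, v)\<close> is a polynomial \<open>q\<close> of degree \<open>n + 1\<close>, nonnegative on \<open>[0, 1]\<close>, which must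
  vanish at all atoms of a measure representing \<open>(x, v)\<close>. Interior roots of \<open>q\<close> are double, so there
  are few of them; the sign of the leading coefficient of \<open>q\<close>, negative for the largest and positive
  for the smallest \<open>v\<close>, settles which endpoints can occur in the critical cases.

  In particular the prescribed value is unique, being a root of a determinant with only one root.
\<close>

section \<open>Hankel determinants as Gram determinants\<close>

text \<open>
  The Riesz functional of the moment sequence \<open>z\<close>: the linear functional with \<open>X\<^sup>k \<mapsto> z k\<close>. The
  bound \<open>M\<close> is a fixed number of moments rather than the degree of \<open>f\<close>, which makes linearity
  immediate.
\<close>

definition riesz :: "nat \<Rightarrow> (nat \<Rightarrow> real) \<Rightarrow> real poly \<Rightarrow> real" where
  "riesz M z f = (\<Sum>k\<le>M. coeff f k * z k)"

lemma riesz_diff: "riesz M z (f - g) = riesz M z f - riesz M z g"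
  by (simp add: riesz_def algebra_simps sum_subtractf)

lemma riesz_smult: "riesz M z (Polynomial.smult c f) = c * riesz M z f"
  by (simp add: riesz_def sum_distrib_left mult.assoc)

lemma riesz_sum: "riesz M z (\<Sum>a\<in>A. f a) = (\<Sum>a\<in>A. riesz M z (f a))"
  unfolding riesz_def coeff_sum sum_distrib_right by (rule sum.swap)

lemma riesz_monom: "k \<le> M \<Longrightarrow> riesz M z (Polynomial.monom c k) = c * z k"
  by (simp add: riesz_def if_distrib[of "\<lambda>c. c * _"] cong: if_cong)

text \<open>
  The Gram matrix of the form \<open>(p, r) \<mapsto> L(w p r)\<close> on polynomials of degree below \<open>N\<close>, in the basis
  of monomials, where \<open>L\<close> is the Riesz functional of \<open>z\<close>. The weights \<open>1\<close>, \<open>X\<close>, \<open>1 - X\<close> and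
  \<open>X (1 - X)\<close> turn it into the four Hankel matrices.
\<close>

definition moment_matrix :: "nat \<Rightarrow> real poly \<Rightarrow> nat \<Rightarrow> (nat \<Rightarrow> real) \<Rightarrow> real Matrix.mat" where
  "moment_matrix M w N z = Matrix.mat N N (\<lambda>(i, j). riesz M z (w * Polynomial.monom 1 (i + j)))"

lemma poly_eq_sum_monom:
  fixes p :: "real poly"
  assumes "degree p < N"
  shows "p = (\<Sum>j<N. Polynomial.smult (coeff p j) (Polynomial.monom 1 j))"
proof (rule poly_eqI)
  fix k
  have "coeff p k = 0" if "\<not> k < N"
    using that assms by (intro coeff_eq_0) simp
  moreover have "coeff p j * (if j = k then 1 else 0) = (if j = k then coeff p j else 0)" for j
    by simp
  ultimately show "coeff p k = coeff (\<Sum>j<N. Polynomial.smult (coeff p j) (Polynomial.monom 1 j)) k"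
    by (simp add: coeff_sum del: mult_zero_right)
qed

lemma moment_matrix_row:
  assumes "degree p < N" and "i < N"
  shows "vec_index (moment_matrix M w N z *\<^sub>v Matrix.vec N (coeff p)) i
    = riesz M z (w * p * Polynomial.monom 1 i)"
proof -
  have "w * p * Polynomial.monom 1 i = (\<Sum>j<N. Polynomial.smult (coeff p j) (w * Polynomial.monom 1 (i + j)))"
    by (subst poly_eq_sum_monom[OF assms(1)])
       (simp add: sum_distrib_left sum_distrib_right mult_monom add.commute mult.assoc)
  then show ?thesis
    using assms by (simp add: moment_matrix_def riesz_sum riesz_smult scalar_prod_def
        atLeast0LessThan mult.commute)
qed

text \<open>
  A kernel vector of the matrix is the coefficient vector of a polynomial that is orthogonal, for
  the weight \<open>w\<close>, to everything of degree below \<open>N\<close>. In this form the vanishing of the determinant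
  can be used without any expansion of it.
\<close>

lemma det_moment_matrix_eq_0_iff:
  "Determinant.det (moment_matrix M w N z) = 0 \<longleftrightarrow>
   (\<exists>p. p \<noteq> 0 \<and> degree p < N \<and> (\<forall>r. degree r < N \<longrightarrow> riesz M z (w * p * r) = 0))"
proof -
  let ?A = "moment_matrix M w N z"
  have A: "?A \<in> carrier_mat N N"
    by (simp add: moment_matrix_def)
  have orth: "?A *\<^sub>v Matrix.vec N (coeff p) = 0\<^sub>v N \<longleftrightarrow>
      (\<forall>r. degree r < N \<longrightarrow> riesz M z (w * p * r) = 0)" if p: "degree p < N" for p
  proof -
    have "?A *\<^sub>v Matrix.vec N (coeff p) = 0\<^sub>v N \<longleftrightarrow>
        (\<forall>i<N. riesz M z (w * p * Polynomial.monom 1 i) = 0)"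
      using A moment_matrix_row[OF p]
      by (metis (no_types, lifting) carrier_matD(1) dim_mult_mat_vec eq_vecI index_zero_vec(1,2))
    also have "\<dots> \<longleftrightarrow> (\<forall>r. degree r < N \<longrightarrow> riesz M z (w * p * r) = 0)"
    proof safe
      fix r :: "real poly"
      assume 0: "\<forall>i<N. riesz M z (w * p * Polynomial.monom 1 i) = 0" and r: "degree r < N"
      show "riesz M z (w * p * r) = 0"
        by (subst poly_eq_sum_monom[OF r]) (simp add: sum_distrib_left riesz_sum riesz_smult 0)
    next
      fix i assume "\<forall>r. degree r < N \<longrightarrow> riesz M z (w * p * r) = 0" "i < N"
      then show "riesz M z (w * p * Polynomial.monom 1 i) = 0"
        using degree_monom_eq[of "1::real" i] by simp
    qed
    finally show ?thesis .
  qed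
  show ?thesis
  proof
    assume "Determinant.det ?A = 0"
    then obtain v where v: "v \<in> carrier_vec N" "v \<noteq> 0\<^sub>v N" "?A *\<^sub>v v = 0\<^sub>v N"
      using det_0_iff_vec_prod_zero[OF A] by blast
    define p where "p = (\<Sum>j<N. Polynomial.monom (vec_index v j) j)"
    have cp: "coeff p k = (if k < N then vec_index v k else 0)" for k
      by (simp add: p_def coeff_sum)
    have vp: "Matrix.vec N (coeff p) = v"
      using v(1) by (auto simp: cp)
    then have "p \<noteq> 0"
      using v(2) by auto
    moreover from this have "degree p < N"
      by (metis cp leading_coeff_0_iff)
    ultimately show "\<exists>p. p \<noteq> 0 \<and> degree p < N \<and> (\<forall>r. degree r < N \<longrightarrow> riesz M z (w * p * r) = 0)"
      using orth vp v(3) by metis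
  next
    assume "\<exists>p. p \<noteq> 0 \<and> degree p < N \<and> (\<forall>r. degree r < N \<longrightarrow> riesz M z (w * p * r) = 0)"
    then obtain p where p: "p \<noteq> 0" "degree p < N" "?A *\<^sub>v Matrix.vec N (coeff p) = 0\<^sub>v N"
      using orth by blast
    have "Matrix.vec N (coeff p) \<noteq> 0\<^sub>v N"
      using p(1,2) by (metis index_vec index_zero_vec(1) leading_coeff_0_iff)
    then show "Determinant.det ?A = 0"
      using det_0_iff_vec_prod_zero[OF A] p(3) by (metis vec_carrier)
  qed
qed

lemma hankel_S_even: "hankel_S (2 * k) z = Determinant.det (moment_matrix (2 * k) 1 (k + 1) z)"
  unfolding hankel_S_def moment_matrix_def
  by (auto simp: riesz_monom intro!: arg_cong[where f = Determinant.det] cong_mat)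

lemma hankel_S_odd:
  "hankel_S (2 * k + 1) z = Determinant.det (moment_matrix (2 * k + 1) [:0, 1:] (k + 1) z)"
proof -
  have *: "[:0, 1:] * Polynomial.monom 1 m = (Polynomial.monom 1 (m + 1) :: real poly)" for m
    by (simp add: monom_Suc)
  show ?thesis
    unfolding hankel_S_def moment_matrix_def *
    by (auto simp: riesz_monom intro!: arg_cong[where f = Determinant.det] cong_mat)
qed

lemma hankel_K_even:
  "hankel_K (2 * k) z = Determinant.det (moment_matrix (2 * k) [:0, 1, -1:] k z)"
proof -
  have *: "[:0, 1, -1:] * Polynomial.monom 1 m = (Polynomial.monom 1 (m + 1) - Polynomial.monom 1 (m + 2) :: real poly)" for m
    by (simp add: monom_Suc numeral_2_eq_2)
  show ?thesis
    unfolding hankel_K_def moment_matrix_def *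
    by (auto simp: riesz_diff riesz_monom intro!: arg_cong[where f = Determinant.det] cong_mat)
qed

lemma hankel_K_odd:
  "hankel_K (2 * k + 1) z = Determinant.det (moment_matrix (2 * k + 1) [:1, -1:] (k + 1) z)"
proof -
  have *: "[:1, -1:] * Polynomial.monom 1 m = (Polynomial.monom 1 m - Polynomial.monom 1 (m + 1) :: real poly)" for m
    by (simp add: monom_Suc)
  show ?thesis
    unfolding hankel_K_def moment_matrix_def *
    by (auto simp: riesz_diff riesz_monom intro!: arg_cong[where f = Determinant.det] cong_mat)
qed

section \<open>The Riesz functional at a point of the moment space\<close>

lemma riesz_extend_point:
  fixes e :: "'n::finite \<Rightarrow> nat"
  assumes "bij_betw e UNIV {1..CARD('n)}"
  shows "riesz (CARD('n) + 1) (extend_point e x v) f =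
    coeff f 0 + (\<Sum>i\<in>UNIV. coeff f (e i) * x $ i) + coeff f (CARD('n) + 1) * v"
proof -
  let ?n = "CARD('n)"
  have "{..?n + 1} = insert 0 (insert (?n + 1) {1..?n})"
    by auto
  then have "riesz (?n + 1) (extend_point e x v) f =
      coeff f 0 + (\<Sum>k\<in>{1..?n}. coeff f k * extend_point e x v k) + coeff f (?n + 1) * v"
    by (simp add: riesz_def extend_point_def)
  also have "(\<Sum>k\<in>{1..?n}. coeff f k * extend_point e x v k) =
      (\<Sum>k\<in>{1..?n}. coeff f k * x $ inv_into UNIV e k)"
    by (rule sum.cong) (auto simp: extend_point_def)
  also have "\<dots> = (\<Sum>i\<in>UNIV. coeff f (e i) * x $ i)"
    using assms by (subst sum.reindex_bij_betw[OF assms, symmetric])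
      (simp add: bij_betw_def)
  finally show ?thesis .
qed

lemma poly_eq_riesz_curve:
  fixes e :: "'n::finite \<Rightarrow> nat"
  assumes "bij_betw e UNIV {1..CARD('n)}" and "degree f \<le> CARD('n) + 1"
  shows "poly f t = riesz (CARD('n) + 1) (extend_point e (gamma_bar e t) (gamma_last TYPE('n) t)) f"
proof -
  have "extend_point e (gamma_bar e t) (gamma_last TYPE('n) t) k = t ^ k" if "k \<le> CARD('n) + 1" for k
  proof -
    have "e (inv_into UNIV e k) = k" if "0 < k" "k \<le> CARD('n)"
      using bij_betw_inv_into_right[OF assms(1)] that by auto
    then show ?thesis
      using that by (auto simp: extend_point_def gamma_bar_def gamma_last_def le_Suc_eq)
  qed
  moreover have "poly f t = (\<Sum>k\<le>CARD('n) + 1. coeff f k * t ^ k)"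
    using assms(2) unfolding poly_altdef
    by (intro sum.mono_neutral_left) (auto simp: coeff_eq_0)
  ultimately show ?thesis
    by (simp add: riesz_def)
qed

text \<open>
  On a combination of points of the curve, the Riesz functional integrates against the
  corresponding measure with finitely many atoms.
\<close>

lemma riesz_combination:
  fixes e :: "'n::finite \<Rightarrow> nat"
  assumes e: "bij_betw e UNIV {1..CARD('n)}" and f: "degree f \<le> CARD('n) + 1"
    and u: "sum u A = 1"
    and x: "x = (\<Sum>a\<in>A. u a *\<^sub>R gamma_bar e (t a))"
    and v: "v = (\<Sum>a\<in>A. u a * gamma_last TYPE('n) (t a))"
  shows "riesz (CARD('n) + 1) (extend_point e x v) f = (\<Sum>a\<in>A. u a * poly f (t a))"
proof -
  have "(\<Sum>i\<in>UNIV. coeff f (e i) * x $ i) =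
      (\<Sum>a\<in>A. u a * (\<Sum>i\<in>UNIV. coeff f (e i) * gamma_bar e (t a) $ i))"
    unfolding x sum_component vector_scaleR_component sum_distrib_left
    by (subst sum.swap) (simp add: mult_ac)
  moreover have "coeff f 0 = (\<Sum>a\<in>A. u a * coeff f 0)"
    by (simp add: u flip: sum_distrib_right)
  ultimately show ?thesis
    unfolding poly_eq_riesz_curve[OF e f] riesz_extend_point[OF e] distrib_left sum.distrib v
    by (simp add: sum_distrib_left mult_ac)
qed

text \<open>
  A polynomial \<open>p\<close> for which \<open>w p\<close> vanishes at all atoms of a representation is in the kernel,
  because there the functional is evaluation at the atoms.
\<close>

lemma det_moment_matrix_combination:
  fixes e :: "'n::finite \<Rightarrow> nat"
  assumes e: "bij_betw e UNIV {1..CARD('n)}"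
    and w: "degree w + 2 * (N - 1) \<le> CARD('n) + 1"
    and u: "sum u A = 1"
    and x: "x = (\<Sum>a\<in>A. u a *\<^sub>R gamma_bar e (t a))"
    and v: "v = (\<Sum>a\<in>A. u a * gamma_last TYPE('n) (t a))"
    and p: "p \<noteq> 0" "degree p < N" "\<And>a. a \<in> A \<Longrightarrow> poly (w * p) (t a) = 0"
  shows "Determinant.det (moment_matrix (CARD('n) + 1) w N (extend_point e x v)) = 0"
  unfolding det_moment_matrix_eq_0_iff
proof (intro exI conjI allI impI)
  fix r :: "real poly" assume r: "degree r < N"
  have "degree (w * p * r) \<le> CARD('n) + 1"
    using degree_mult_le[of "w * p" r] degree_mult_le[of w p] w p(2) r by linarith
  from riesz_combination[OF e this u x v]
  show "riesz (CARD('n) + 1) (extend_point e x v) (w * p * r) = 0"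
    using p(3) by (simp add: sum.neutral)
qed (use p in auto)

text \<open>
  Since \<open>deg f \<le> n\<close>, the value of the functional at \<open>f\<close> is an affine function of \<open>x\<close> alone. It is
  nonnegative on the curve, hence on the convex hull. If it is not constant, it is therefore positive
  in the interior; if it is constant, then so is \<open>f\<close>.
\<close>

lemma riesz_pos:
  fixes e :: "'n::finite \<Rightarrow> nat"
  assumes e: "bij_betw e UNIV {1..CARD('n)}"
    and x: "x \<in> interior (convex hull (gamma_bar e ` {0..1}))"
    and f: "f \<noteq> 0" "degree f \<le> CARD('n)" "\<And>t. t \<in> {0..1} \<Longrightarrow> 0 \<le> poly f t"
  shows "0 < riesz (CARD('n) + 1) (extend_point e x v) f"
proof -
  define a :: "real ^ 'n" where "a = (\<chi> i. coeff f (e i))"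
  have ext: "riesz (CARD('n) + 1) (extend_point e y s) f = coeff f 0 + a \<bullet> y" for y s
    unfolding riesz_extend_point[OF e] using f(2) by (simp add: a_def inner_vec_def coeff_eq_0)
  have "a \<bullet> gamma_bar e t \<ge> - coeff f 0" if "t \<in> {0..1}" for t
    using f(3)[OF that] unfolding poly_eq_riesz_curve[OF e trans_le_add1[OF f(2)]] ext
    by simp
  then have "convex hull (gamma_bar e ` {0..1}) \<subseteq> {y. a \<bullet> y \<ge> - coeff f 0}"
    by (intro hull_minimal) (auto simp: convex_halfspace_ge)
  then have half: "x \<in> interior {y. a \<bullet> y \<ge> - coeff f 0}"
    using x interior_mono by blast
  show ?thesis
  proof (cases "a = 0")
    case True
    have "coeff f k = 0" if "k \<noteq> 0" for k
    proof (cases "k \<le> CARD('n)")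
      case True
      then have "k \<in> e ` UNIV"
        using that unfolding bij_betw_imp_surj_on[OF e] by simp
      then obtain i where "k = e i"
        by blast
      then show ?thesis
        using \<open>a = 0\<close> by (metis a_def vec_lambda_beta zero_index)
    qed (use f(2) in \<open>simp add: coeff_eq_0\<close>)
    then have "coeff f 0 \<noteq> 0"
      using f(1) by (metis leading_coeff_0_iff)
    moreover have "coeff f 0 \<ge> 0"
      using f(3)[of 0] by (simp add: poly_0_coeff_0)
    ultimately show ?thesis
      unfolding ext by (simp add: True)
  next
    case False
    then show ?thesis
      using half unfolding ext by (simp add: interior_halfspace_ge)
  qed
qed

text \<open>
  Let \<open>p\<close> and \<open>q\<close> be kernel polynomials for \<open>v\<close> and \<open>v'\<close>. By orthogonality both functionals vanish
  on \<open>w p q\<close>, and they differ there by \<open>(v - v')\<close> times the coefficient of degree \<open>n + 1\<close>. That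
  coefficient is not zero: a kernel polynomial of degree below \<open>N - 1\<close> would give \<open>L(w p\<^sup>2) = 0\<close>
  for a nonnegative polynomial \<open>w p\<^sup>2\<close> of degree at most \<open>n\<close>, against positivity.
\<close>

lemma det_moment_matrix_zero_unique:
  fixes e :: "'n::finite \<Rightarrow> nat"
  assumes e: "bij_betw e UNIV {1..CARD('n)}"
    and x: "x \<in> interior (convex hull (gamma_bar e ` {0..1}))"
    and w: "w \<noteq> 0" "degree w + 2 * (N - 1) = CARD('n) + 1" "\<And>t. t \<in> {0..1} \<Longrightarrow> 0 \<le> poly w t"
    and 1: "Determinant.det (moment_matrix (CARD('n) + 1) w N (extend_point e x v)) = 0"
    and 2: "Determinant.det (moment_matrix (CARD('n) + 1) w N (extend_point e x v')) = 0"
  shows "v = v'"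
proof -
  let ?L = "\<lambda>v. riesz (CARD('n) + 1) (extend_point e x v)"
  have top: "degree p = N - 1"
    if p: "p \<noteq> 0" "degree p < N" "\<And>r. degree r < N \<Longrightarrow> ?L v (w * p * r) = 0" for p v
  proof (rule ccontr)
    assume "degree p \<noteq> N - 1"
    then have "degree (w * p * p) \<le> CARD('n)"
      using p(1,2) w(1,2) by (simp add: degree_mult_eq)
    moreover have "0 \<le> poly (w * p * p) t" if "t \<in> {0..1}" for t
      using w(3)[OF that] by (simp add: mult.assoc)
    ultimately have "0 < ?L v (w * p * p)"
      using p(1) w(1) by (intro riesz_pos[OF e x]) auto
    then show False
      using p(2,3) by simp
  qed
  from 1 obtain p where p: "p \<noteq> 0" "degree p < N"
      "\<And>r. degree r < N \<Longrightarrow> ?L v (w * p * r) = 0"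
    unfolding det_moment_matrix_eq_0_iff by blast
  from 2 obtain q where q: "q \<noteq> 0" "degree q < N"
      "\<And>r. degree r < N \<Longrightarrow> ?L v' (w * q * r) = 0"
    unfolding det_moment_matrix_eq_0_iff by blast
  have "?L v (w * p * q) = 0" "?L v' (w * p * q) = 0"
    using p(3)[OF q(2)] q(3)[OF p(2)] by (simp_all add: mult_ac)
  then have "coeff (w * p * q) (CARD('n) + 1) * (v - v') = 0"
    unfolding riesz_extend_point[OF e] right_diff_distrib by linarith
  moreover have "degree (w * p * q) = CARD('n) + 1"
    using w(1,2) p(1) q(1) top[OF p] top[OF q] by (simp add: degree_mult_eq)
  then have "coeff (w * p * q) (CARD('n) + 1) \<noteq> 0"
    using w(1) p(1) q(1) by (metis leading_coeff_0_iff mult_eq_0_iff)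
  ultimately show ?thesis
    by simp
qed

section \<open>Roots of nonnegative polynomials on the unit interval\<close>

text \<open>
  For \<open>t \<in> [0, 1]\<close>, a polynomial of least degree among those that are nonnegative on \<open>[0, 1]\<close> and have
  a root at \<open>t\<close>: an interior root of a nonnegative polynomial is at least double.
\<close>

definition node_factor :: "real \<Rightarrow> real poly" where
  "node_factor t = (if t = 0 then [:0, 1:] else if t = 1 then [:1, -1:] else [:- t, 1:]\<^sup>2)"

lemma poly_node_factor_eq_0_iff: "poly (node_factor t) s = 0 \<longleftrightarrow> s = t"
  by (auto simp: node_factor_def)

lemma node_factor_neq_0: "node_factor t \<noteq> 0"
  using poly_node_factor_eq_0_iff[of t "t + 1"] by auto

lemma degree_node_factor: "degree (node_factor t) = (if t \<in> {0, 1} then 1 else 2)"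
  by (auto simp: node_factor_def degree_power_eq)

lemma lead_coeff_node_factor: "lead_coeff (node_factor t) = (if t = 1 then - 1 else 1)"
  by (auto simp: node_factor_def lead_coeff_power)

lemma poly_nonneg_limit:
  fixes p :: "real poly"
  assumes t: "t \<in> {0..1}" and p: "\<And>s. s \<in> {0..1} - {t} \<Longrightarrow> 0 \<le> poly p s"
  shows "0 \<le> poly p t"
proof (cases "t < 1")
  case True
  have "eventually (\<lambda>s. 0 \<le> poly p s) (at_right t)"
    using True t p by (intro eventually_at_rightI[of t 1]) auto
  moreover have "(poly p \<longlongrightarrow> poly p t) (at_right t)"
    by (intro tendsto_poly tendsto_ident_at)
  ultimately show ?thesis
    by (intro tendsto_lowerbound[where F = "at_right t"]) auto
next
  case False
  have "eventually (\<lambda>s. 0 \<le> poly p s) (at_left t)"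
    using False t p by (intro eventually_at_leftI[of 0 t]) auto
  moreover have "(poly p \<longlongrightarrow> poly p t) (at_left t)"
    by (intro tendsto_poly tendsto_ident_at)
  ultimately show ?thesis
    by (intro tendsto_lowerbound[where F = "at_left t"]) auto
qed

text \<open>
  A root in the open interval is a local minimum, so the derivative vanishes there too and the root is
  double. The quotient inherits the sign of \<open>q\<close> away from \<open>t\<close>, and at \<open>t\<close> by continuity.
\<close>

lemma nonneg_poly_factor_root:
  assumes t: "t \<in> {0..1}" and q: "\<And>s. s \<in> {0..1} \<Longrightarrow> 0 \<le> poly q s" and 0: "poly q t = 0"
  obtains r where "q = node_factor t * r" and "\<And>s. s \<in> {0..1} \<Longrightarrow> 0 \<le> poly r s"
proof -
  obtain p where p: "q = [:- t, 1:] * p"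
    using 0 unfolding poly_eq_0_iff_dvd by (elim dvdE)
  have "\<exists>r. q = node_factor t * r \<and> (\<forall>s \<in> {0..1} - {t}. 0 \<le> poly r s)"
  proof (cases "t = 0 \<or> t = 1")
    case True
    then show ?thesis
    proof
      assume "t = 0"
      then have "0 \<le> poly p s" if "s \<in> {0..1} - {t}" for s
        using q[of s] that by (simp add: p zero_le_mult_iff)
      then show ?thesis
        using p \<open>t = 0\<close> by (intro exI[of _ p]) (simp add: node_factor_def)
    next
      assume "t = 1"
      have "0 \<le> poly (- p) s" if "s \<in> {0..1} - {t}" for s
      proof -
        have "poly q s = (s - 1) * poly p s"
          using \<open>t = 1\<close> by (simp add: p algebra_simps)
        then have "0 \<le> (s - 1) * poly p s" "s - 1 < 0"
          using q[of s] that \<open>t = 1\<close> by auto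
        then show ?thesis
          by (simp add: zero_le_mult_iff)
      qed
      moreover have "q = [:1, -1:] * (- p)"
        using p \<open>t = 1\<close> by simp
      ultimately show ?thesis
        using \<open>t = 1\<close> by (intro exI[of _ "- p"]) (simp add: node_factor_def)
    qed
  next
    case False
    have "DERIV (poly q) t :> poly (pderiv q) t"
      by (rule poly_DERIV)
    moreover have "\<forall>s. \<bar>t - s\<bar> < min t (1 - t) \<longrightarrow> poly q t \<le> poly q s"
      using 0 q by (auto simp: abs_less_iff)
    ultimately have "poly (pderiv q) t = 0"
      using False t by (intro DERIV_local_min[of "poly q" _ t "min t (1 - t)"]) auto
    then have "poly p t = 0"
      unfolding p pderiv_mult by (simp add: pderiv_pCons)
    then obtain r where pr: "p = [:- t, 1:] * r"
      unfolding poly_eq_0_iff_dvd by (elim dvdE)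
    then have r: "q = [:- t, 1:]\<^sup>2 * r"
      by (simp only: p pr power2_eq_square mult.assoc)
    have "0 \<le> poly r s" if "s \<in> {0..1} - {t}" for s
    proof -
      have "0 \<le> (s - t)\<^sup>2 * poly r s" "0 < (s - t)\<^sup>2"
        using q[of s] that by (auto simp: r)
      then show ?thesis
        by (simp add: zero_le_mult_iff)
    qed
    then show ?thesis
      using r False by (intro exI[of _ r]) (simp add: node_factor_def)
  qed
  then show thesis
    using that poly_nonneg_limit[OF t] by (metis Diff_iff singletonD)
qed

text \<open>
  The node factors are split off one by one. The quotient must stay nonnegative for this, since that is
  what makes its remaining interior roots double.
\<close>

lemma nonneg_poly_factor_roots:
  assumes "finite T" and "T \<subseteq> {0..1}"
    and q: "\<And>s. s \<in> {0..1} \<Longrightarrow> 0 \<le> poly q s" and "\<And>t. t \<in> T \<Longrightarrow> poly q t = 0"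
  shows "\<exists>r. q = (\<Prod>t\<in>T. node_factor t) * r \<and> (\<forall>s \<in> {0..1}. 0 \<le> poly r s)"
  using assms(1,2,4)
proof (induction T)
  case empty
  then show ?case
    using q by auto
next
  case (insert t T)
  have "\<exists>r. q = (\<Prod>t\<in>T. node_factor t) * r \<and> (\<forall>s \<in> {0..1}. 0 \<le> poly r s)"
    by (rule insert.IH) (use insert.prems in auto)
  then obtain r where r: "q = (\<Prod>t\<in>T. node_factor t) * r" "\<And>s. s \<in> {0..1} \<Longrightarrow> 0 \<le> poly r s"
    by blast
  have "poly (\<Prod>t\<in>T. node_factor t) t \<noteq> 0"
    using insert.hyps by (auto simp: poly_prod poly_node_factor_eq_0_iff)
  then have "poly r t = 0"
    using insert.prems(2)[of t] r(1) by simp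
  then obtain r' where "r = node_factor t * r'" "\<And>s. s \<in> {0..1} \<Longrightarrow> 0 \<le> poly r' s"
    using nonneg_poly_factor_root[of t r] insert.prems(1) r(2) by blast
  then show ?case
    using r(1) insert.hyps by (intro exI[of _ r']) (simp add: mult_ac)
qed

text \<open>
  Nonnegative polynomials are divisible by their node factors with a nonnegative quotient, so roots
  at the endpoints cost one degree and the others two. If the degree is used up, the quotient is a
  positive constant, and the only node factor with negative leading coefficient is \<open>1 - X\<close>.
\<close>

lemma nonneg_poly_roots_bound:
  fixes q :: "real poly"
  assumes T: "finite T" "T \<subseteq> {0..1}"
    and q: "q \<noteq> 0" "\<And>s. s \<in> {0..1} \<Longrightarrow> 0 \<le> poly q s" "\<And>t. t \<in> T \<Longrightarrow> poly q t = 0"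
  shows "card T + card (T - {0, 1}) \<le> degree q"
    and "card T + card (T - {0, 1}) = degree q \<Longrightarrow> 0 < lead_coeff q \<longleftrightarrow> 1 \<notin> T"
proof -
  define P where "P = (\<Prod>t\<in>T. node_factor t)"
  obtain r where r: "q = P * r" "\<And>s. s \<in> {0..1} \<Longrightarrow> 0 \<le> poly r s"
    using nonneg_poly_factor_roots[OF T q(2,3)] unfolding P_def by blast
  have "degree P = (\<Sum>t\<in>T. degree (node_factor t))"
    unfolding P_def by (rule degree_prod_eq_sum_degree) (simp add: node_factor_neq_0)
  also have "\<dots> = (\<Sum>t\<in>T. 1 + (if t \<in> - {0, 1} then 1 else 0))"
    by (rule sum.cong) (auto simp: degree_node_factor)
  also have "\<dots> = card T + (\<Sum>t\<in>T \<inter> - {0, 1}. 1)"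
    by (simp only: sum.distrib sum.inter_restrict[OF T(1)] card_eq_sum)
  also have "\<dots> = card T + card (T - {0, 1})"
    by (simp only: card_eq_sum Diff_eq)
  finally have P: "degree P = card T + card (T - {0, 1})" .
  have lead: "lead_coeff P = (if 1 \<in> T then - 1 else 1)"
    unfolding P_def lead_coeff_prod lead_coeff_node_factor using T(1) by (simp add: prod.delta)
  have "r \<noteq> 0" "P \<noteq> 0"
    using q(1) r(1) by auto
  then have deg: "degree q = degree P + degree r"
    using r(1) by (simp add: degree_mult_eq)
  then show "card T + card (T - {0, 1}) \<le> degree q"
    by (simp add: P)
  show "0 < lead_coeff q \<longleftrightarrow> 1 \<notin> T" if "card T + card (T - {0, 1}) = degree q"
  proof -
    have "degree r = 0"
      using deg that P by linarith
    then obtain c where c: "r = [:c:]"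
      by (elim degree_eq_zeroE)
    then have "0 < c"
      using r(2)[of 0] \<open>r \<noteq> 0\<close> by auto
    then show ?thesis
      unfolding r(1) lead_coeff_mult lead by (simp add: c)
  qed
qed

text \<open>
  With \<open>m\<close> roots in the open interval, the left side is \<open>2 m + [0 \<in> T]\<close>: the endpoint \<open>1\<close> is free of
  charge. If it is a root, it takes a degree of its own; if not, a negative leading coefficient
  excludes equality in the general bound.
\<close>

lemma sup_nodes_bound:
  fixes q :: "real poly"
  assumes T: "finite T" "T \<subseteq> {0..1}"
    and q: "lead_coeff q < 0" "\<And>s. s \<in> {0..1} \<Longrightarrow> 0 \<le> poly q s" "\<And>t. t \<in> T \<Longrightarrow> poly q t = 0"
  shows "card (T - {1}) + card (T - {0, 1}) < degree q"
proof -
  have "q \<noteq> 0"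
    using q(1) by auto
  note b = nonneg_poly_roots_bound[OF T this q(2,3)]
  show ?thesis
  proof (cases "1 \<in> T")
    case True
    then show ?thesis
      using b(1) card_Diff1_less[OF T(1) True] by linarith
  next
    case False
    then show ?thesis
      using b q(1) by (auto simp: order_le_less)
  qed
qed

text \<open>
  With \<open>m\<close> roots in the open interval, the left side is \<open>2 m + [0 \<in> T] + 2 [1 \<in> T]\<close>: the endpoint \<open>1\<close>
  counts like an interior root, because with \<open>1\<close> as a root a positive leading coefficient excludes
  equality in the general bound.
\<close>

lemma inf_nodes_bound:
  fixes q :: "real poly"
  assumes T: "finite T" "T \<subseteq> {0..1}"
    and q: "0 < lead_coeff q" "\<And>s. s \<in> {0..1} \<Longrightarrow> 0 \<le> poly q s" "\<And>t. t \<in> T \<Longrightarrow> poly q t = 0"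
  shows "card T + card (T - {0}) \<le> degree q"
proof -
  have "q \<noteq> 0"
    using q(1) by auto
  note b = nonneg_poly_roots_bound[OF T this q(2,3)]
  show ?thesis
  proof (cases "1 \<in> T")
    case True
    then have "T - {0} = insert 1 (T - {0, 1})"
      by auto
    then have "card (T - {0}) = card (T - {0, 1}) + 1"
      using T(1) by simp
    moreover have "card T + card (T - {0, 1}) \<noteq> degree q"
      using True b(2) q(1) by auto
    ultimately show ?thesis
      using b(1) by linarith
  next
    case False
    then have "T - {0} = T - {0, 1}"
      by auto
    then show ?thesis
      using b(1) by simp
  qed
qed

section \<open>Representations of an extreme value\<close>

text \<open>
  The point \<open>(x, v)\<close> is taken extreme in the fibre over \<open>x\<close> of the convex hull of the curve in
  \<open>\<real>\<^sup>n\<^sup>+\<^sup>1\<close>, the highest one for \<open>s > 0\<close> and the lowest one for \<open>s < 0\<close>. A hyperplane separating the hull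
  from the open ray beyond \<open>(x, v)\<close> is a polynomial \<open>q\<close> that is nonnegative on \<open>[0, 1]\<close> and has mean
  \<open>0\<close> against any measure representing \<open>(x, v)\<close>; so all atoms are roots of \<open>q\<close>. The direction of the
  ray determines the sign of the leading coefficient, and the hyperplane is not vertical because \<open>x\<close>
  is an interior point.
\<close>

lemma extremal_combination:
  fixes e :: "'n::finite \<Rightarrow> nat"
  assumes e: "bij_betw e UNIV {1..CARD('n)}"
    and x: "x \<in> interior (convex hull (gamma_bar e ` {0..1}))"
    and s: "s \<noteq> 0"
  obtains T u v q where "finite T" and "T \<subseteq> {0..1}" and "\<forall>t\<in>T. 0 < u t" and "sum u T = 1"
    and "x = (\<Sum>t\<in>T. u t *\<^sub>R gamma_bar e t)" and "v = (\<Sum>t\<in>T. u t * gamma_last TYPE('n) t)"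
    and "degree q = CARD('n) + 1" and "s * lead_coeff q < 0"
    and "\<forall>t\<in>{0..1}. 0 \<le> poly q t" and "\<forall>t\<in>T. poly q t = 0"
proof -
  let ?n = "CARD('n)"
  define g where "g t = (gamma_bar e t, gamma_last TYPE('n) t)" for t
  define C where "C = convex hull (g ` {0..1})"
  have "continuous_on {0..1} g"
    unfolding g_def gamma_bar_def gamma_last_def by (intro continuous_intros)
  then have C: "compact C"
    unfolding C_def by (intro compact_convex_hull compact_continuous_image) auto
  define F where "F = C \<inter> {z. fst z = x}"
  have "compact F"
    unfolding F_def using C by (intro compact_Int_closed closed_Collect_eq continuous_intros)
  moreover have "fst ` C = convex hull (gamma_bar e ` {0..1})"
    unfolding C_def by (simp add: convex_hull_linear_image[OF linear_fst] image_image g_def)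
  then have "F \<noteq> {}"
    using x interior_subset by (fastforce simp: F_def)
  ultimately obtain z where z: "z \<in> F" "\<And>z'. z' \<in> F \<Longrightarrow> s * snd z' \<le> s * snd z"
    using continuous_attains_sup[of F "\<lambda>z. s * snd z"] by (force intro: continuous_intros)
  define v where "v = snd z"
  have zC: "(x, v) \<in> C"
    using z(1) by (auto simp: F_def v_def)
  \<comment> \<open>The open ray beyond \<open>(x, v)\<close> in the direction of \<open>s\<close>; its points have the form \<open>(x, v + d s)\<close>.\<close>
  let ?R = "{x} \<times> {y. s * v < s * y}"
  have "?R \<inter> C = {}"
    using z(2) by (force simp: F_def v_def)
  moreover have "convex ?R"
    using convex_halfspace_gt[of "s * v" s] by (intro convex_Times) auto
  moreover have ray: "(x, v + d * s) \<in> ?R" if "0 < d" for d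
  proof -
    have "0 < d * (s * s)"
      using that s by (auto simp: zero_less_mult_iff not_less_iff_gr_or_eq)
    then show ?thesis
      by (simp add: algebra_simps)
  qed
  have "(x, v + 1 * s) \<in> ?R"
    by (rule ray) simp
  then have "?R \<noteq> {}"
    by (metis empty_iff)
  moreover have "C \<noteq> {}"
    using zC by auto
  moreover have "convex C"
    unfolding C_def by (rule convex_convex_hull)
  ultimately have "\<exists>a \<beta>. a \<noteq> 0 \<and> (\<forall>z\<in>?R. a \<bullet> z \<le> \<beta>) \<and> (\<forall>z\<in>C. \<beta> \<le> a \<bullet> z)"
    by (intro separating_hyperplane_sets)
  then obtain a \<beta> where a: "a \<noteq> 0" "\<And>z. z \<in> ?R \<Longrightarrow> a \<bullet> z \<le> \<beta>" "\<And>z. z \<in> C \<Longrightarrow> \<beta> \<le> a \<bullet> z"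
    by blast
  obtain \<alpha> b where ab: "a = (\<alpha>, b)"
    by fastforce
  have below: "\<alpha> \<bullet> x + b * v + d * (b * s) \<le> \<beta>" if "0 < d" for d
    using a(2)[OF ray[OF that]] by (simp add: ab algebra_simps)
  have above: "\<beta> \<le> \<alpha> \<bullet> x + b * v"
    using a(3)[OF zC] by (simp add: ab)
  have bs: "b * s \<le> 0"
    using below[of 1] above by linarith
  have touch: "\<alpha> \<bullet> x + b * v = \<beta>"
  proof (rule ccontr)
    assume "\<alpha> \<bullet> x + b * v \<noteq> \<beta>"
    then have gap: "0 < \<alpha> \<bullet> x + b * v - \<beta>"
      using above by simp
    \<comment> \<open>Along the ray the excess over \<open>\<beta>\<close> drops by \<open>- d (b s)\<close>; for this \<open>d\<close> the value \<open>d > 0\<close> is left.\<close>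
    define d where "d = (\<alpha> \<bullet> x + b * v - \<beta>) / (1 - b * s)"
    have "0 < d"
      using gap bs by (simp add: d_def)
    moreover have "1 - b * s \<noteq> 0"
      using bs by linarith
    from nonzero_divide_eq_eq[OF this, THEN iffD1, OF d_def[symmetric]]
    have "\<alpha> \<bullet> x + b * v - \<beta> = d * (1 - b * s)" .
    ultimately show False
      using below[of d] by (simp add: right_diff_distrib)
  qed
  \<comment> \<open>The affine function \<open>a \<bullet> z - \<beta>\<close> along the curve.\<close>
  define q where "q = (\<Sum>k\<le>?n + 1. Polynomial.monom
    (if k = 0 then - \<beta> else if k \<le> ?n then \<alpha> $ inv_into UNIV e k else b) k)"
  have coeff_q: "coeff q k = (if k = 0 then - \<beta> else if k \<le> ?n then \<alpha> $ inv_into UNIV e k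
      else if k = ?n + 1 then b else 0)" for k
    by (auto simp: q_def coeff_sum)
  have e_range: "0 < e i" "e i \<le> ?n" for i
    using bij_betwE[OF e] by (auto simp: Suc_le_eq)
  have coeff_qe: "coeff q (e i) = \<alpha> $ i" for i
    using e e_range[of i] by (simp add: coeff_q bij_betw_def)
  have riesz_q: "riesz (?n + 1) (extend_point e y r) q = \<alpha> \<bullet> y + b * r - \<beta>" for y r
    unfolding riesz_extend_point[OF e] coeff_qe by (simp add: coeff_q inner_vec_def)
  have deg_q: "degree q \<le> ?n + 1"
    by (rule degree_le) (auto simp: coeff_q)
  have q_nonneg: "0 \<le> poly q t" if "t \<in> {0..1}" for t
  proof -
    have "g t \<in> C"
      unfolding C_def using that by (intro hull_inc) auto
    then have "\<beta> \<le> a \<bullet> g t"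
      by (rule a(3))
    then show ?thesis
      unfolding poly_eq_riesz_curve[OF e deg_q] riesz_q by (simp add: g_def ab)
  qed
  have "b \<noteq> 0"
  proof
    assume "b = 0"
    then have "\<alpha> \<noteq> 0"
      using a(1) ab by (simp add: zero_prod_def)
    then obtain i where "\<alpha> $ i \<noteq> 0"
      by (auto simp: Finite_Cartesian_Product.vec_eq_iff)
    then have "coeff q (e i) \<noteq> 0"
      by (simp only: coeff_qe not_False_eq_True)
    then have "q \<noteq> 0"
      by (intro notI) (simp only: coeff_0)
    moreover have "degree q \<le> ?n"
      using \<open>b = 0\<close> by (intro degree_le) (auto simp: coeff_q)
    ultimately have "0 < riesz (?n + 1) (extend_point e x v) q"
      using q_nonneg by (intro riesz_pos[OF e x])
    then show False
      using touch unfolding riesz_q by simp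
  qed
  then have top: "coeff q (?n + 1) \<noteq> 0"
    by (simp add: coeff_q)
  then have deg: "degree q = ?n + 1"
    using deg_q le_degree by (intro antisym)
  have lead: "s * lead_coeff q < 0"
    using bs s \<open>b \<noteq> 0\<close> unfolding deg by (simp add: coeff_q mult.commute less_le)
  obtain S w where S: "finite S" "S \<subseteq> g ` {0..1}" "\<And>p. p \<in> S \<Longrightarrow> 0 \<le> w p" "sum w S = 1"
      "(\<Sum>p\<in>S. w p *\<^sub>R p) = (x, v)"
    using zC unfolding C_def convex_hull_explicit mem_Collect_eq by blast
  then obtain T' where T': "T' \<subseteq> {0..1}" "inj_on g T'" "S = g ` T'"
    by (auto simp: subset_image_inj)
  then have fin: "finite T'"
    using S(1) finite_imageD by blast
  \<comment> \<open>Only atoms of positive weight must be roots of \<open>q\<close>.\<close>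
  define T where "T = {t \<in> T'. w (g t) \<noteq> 0}"
  define u where "u t = w (g t)" for t
  have sum_S: "(\<Sum>t\<in>T. u t *\<^sub>R g t) = (x, v)"
    unfolding T_def S(5)[symmetric] T'(3) sum.reindex[OF T'(2)] o_def u_def
    using fin by (intro sum.mono_neutral_left) auto
  have uT: "sum u T = 1"
    unfolding T_def S(4)[symmetric] T'(3) sum.reindex[OF T'(2)] o_def u_def
    using fin by (intro sum.mono_neutral_left) auto
  have T: "finite T" "T \<subseteq> {0..1}"
    using fin T'(1) by (auto simp: T_def)
  have u: "0 < u t" if "t \<in> T" for t
    using that S(3)[of "g t"] T'(3) by (simp add: T_def u_def less_le)
  have xT: "x = (\<Sum>t\<in>T. u t *\<^sub>R gamma_bar e t)"
    using arg_cong[OF sum_S, of fst] by (simp add: fst_sum g_def)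
  have vT: "v = (\<Sum>t\<in>T. u t * gamma_last TYPE('n) t)"
    using arg_cong[OF sum_S, of snd] by (simp add: snd_sum g_def)
  have "(\<Sum>t\<in>T. u t * poly q t) = 0"
    using riesz_combination[OF e deg_q uT xT vT] touch unfolding riesz_q by simp
  moreover have "0 \<le> u t * poly q t" if "t \<in> T" for t
    using u q_nonneg T(2) that by (simp add: less_imp_le subset_iff)
  ultimately have "u t * poly q t = 0" if "t \<in> T" for t
    using that T(1) by (simp add: sum_nonneg_eq_0_iff)
  then have "poly q t = 0" if "t \<in> T" for t
    using u that by fastforce
  with u q_nonneg show thesis
    by (intro that[OF T _ uT xT vT deg lead] ballI)
qed

section \<open>Extremal representations in the prescribed form\<close>

lemma sum_sorted_padding:
  assumes T: "finite T" "card T + a \<le> Suc l"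
  shows "(\<Sum>j=a..l. if j - a < card T then F (sorted_list_of_set T ! (j - a)) else 0) = sum F T"
proof -
  let ?ts = "sorted_list_of_set T"
  have "(\<Sum>j=a..l. if j - a < card T then F (?ts ! (j - a)) else 0) =
      (\<Sum>j\<in>{a..<card T + a}. F (?ts ! (j - a)))"
    using T(2) by (intro sum.mono_neutral_cong_right) auto
  also have "\<dots> = (\<Sum>i<card T. F (?ts ! i))"
    by (rule sum.reindex_bij_witness[of _ "\<lambda>i. i + a" "\<lambda>j. j - a"]) auto
  also have "\<dots> = sum F T"
    using T(1) by (intro sum.reindex_bij_betw bij_betw_nth) auto
  finally show ?thesis .
qed

text \<open>
  The defining formulas of \<open>B\<^sup>s\<^sup>u\<^sup>p\<close> and \<open>B\<^sup>i\<^sup>n\<^sup>f\<close> ask for a prescribed number of nodes in increasing order.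
  A smaller set of nodes is sorted and then filled up with copies of \<open>1\<close> of weight \<open>0\<close>. Two
  functions \<open>f\<close> and \<open>g\<close> are treated at once since the same nodes and weights must serve for the
  point and for its value.
\<close>

lemma combination_sorted:
  fixes f :: "real \<Rightarrow> 'b::real_vector" and g :: "real \<Rightarrow> real"
  assumes T: "finite T" "T \<subseteq> {0..1}" "card T + a \<le> Suc l" and u: "\<And>t. t \<in> T \<Longrightarrow> 0 \<le> u t"
  obtains y c where "y \<in> simplex_ord {a..l}" and "\<forall>j\<in>{a..l}. 0 \<le> c j"
    and "(\<Sum>j=a..l. c j) = sum u T" and "(\<Sum>j=a..l. c j *\<^sub>R f (y j)) = (\<Sum>t\<in>T. u t *\<^sub>R f t)"
    and "(\<Sum>j=a..l. c j * g (y j)) = (\<Sum>t\<in>T. u t * g t)"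
proof
  let ?t = "\<lambda>j. sorted_list_of_set T ! (j - a)"
  let ?y = "\<lambda>j. if j - a < card T then ?t j else 1"
  let ?c = "\<lambda>j. if j - a < card T then u (?t j) else 0"
  have t: "?t j \<in> T" if "j - a < card T" for j
    using that T(1) by (metis nth_mem length_sorted_list_of_set set_sorted_list_of_set)
  then have y: "?y j \<in> {0..1}" for j
    using subsetD[OF T(2), of "?t j"] by (cases "j - a < card T") auto
  have "?y i \<le> ?y j" if "i \<in> {a..l}" "i \<le> j" for i j
  proof (cases "j - a < card T")
    case True
    moreover have "?t i \<le> ?t j"
      using that True by (intro sorted_nth_mono) auto
    ultimately show ?thesis
      using that by auto
  next
    case False
    then show ?thesis
      using y[of i] by auto
  qed
  then show "?y \<in> simplex_ord {a..l}"
    using y unfolding simplex_ord_def by (simp add: mono_on_def)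
  show "\<forall>j\<in>{a..l}. 0 \<le> ?c j"
    using t u by auto
  show "(\<Sum>j=a..l. ?c j) = sum u T"
    by (rule sum_sorted_padding[OF T(1,3)])
  have "(\<Sum>j=a..l. ?c j *\<^sub>R f (?y j)) =
      (\<Sum>j=a..l. if j - a < card T then u (?t j) *\<^sub>R f (?t j) else 0)"
    by (rule sum.cong) auto
  then show "(\<Sum>j=a..l. ?c j *\<^sub>R f (?y j)) = (\<Sum>t\<in>T. u t *\<^sub>R f t)"
    using sum_sorted_padding[OF T(1,3), of "\<lambda>t. u t *\<^sub>R f t"] by simp
  have "(\<Sum>j=a..l. ?c j * g (?y j)) =
      (\<Sum>j=a..l. if j - a < card T then u (?t j) * g (?t j) else 0)"
    by (rule sum.cong) auto
  then show "(\<Sum>j=a..l. ?c j * g (?y j)) = (\<Sum>t\<in>T. u t * g t)"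
    using sum_sorted_padding[OF T(1,3), of "\<lambda>t. u t * g t"] by simp
qed

text \<open>
  In terms of measures: whenever the nodes besides the prescribed endpoints are at most as many as the
  \<open>y\<^sub>j\<close>, in whatever order, the defining formulas apply. The three lemmas after this one treat the other
  formulas in the same way.
\<close>

lemma B_sup_graph_evenI:
  fixes e :: "'n::finite \<Rightarrow> nat"
  assumes n: "CARD('n) = 2 * l"
    and T: "finite T" "T \<subseteq> {0..1}" "card T \<le> l"
    and u: "\<And>t. t \<in> T \<Longrightarrow> 0 \<le> u t" "0 \<le> u1" "sum u T + u1 = 1"
  shows "B_sup_graph e ((\<Sum>t\<in>T. u t *\<^sub>R gamma_bar e t) + u1 *\<^sub>R gamma_bar e 1)
    ((\<Sum>t\<in>T. u t * gamma_last TYPE('n) t) + u1 * gamma_last TYPE('n) 1)"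
proof -
  have card: "card T + 1 \<le> Suc l"
    using T(3) by simp
  obtain y c where y: "y \<in> simplex_ord {1..l}" and c: "\<forall>j\<in>{1..l}. 0 \<le> c j"
    "(\<Sum>j=1..l. c j) = sum u T"
    "(\<Sum>j=1..l. c j *\<^sub>R gamma_bar e (y j)) = (\<Sum>t\<in>T. u t *\<^sub>R gamma_bar e t)"
    "(\<Sum>j=1..l. c j * gamma_last TYPE('n) (y j)) = (\<Sum>t\<in>T. u t * gamma_last TYPE('n) t)"
    by (rule combination_sorted[where f = "gamma_bar e" and g = "gamma_last TYPE('n)",
          OF T(1,2) card u(1)])
  have u1: "1 - sum u T = u1"
    using u(3) by linarith
  have "c \<in> simplex_c {1..l}"
    unfolding simplex_c_def using c(1,2) u(2,3) by auto
  from B_sup_graph.even[OF n this y, of e] show ?thesis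
    unfolding c(2-4) u1 .
qed

lemma B_sup_graph_oddI:
  fixes e :: "'n::finite \<Rightarrow> nat"
  assumes n: "CARD('n) + 1 = 2 * l"
    and T: "finite T" "T \<subseteq> {0..1}" "card T + 1 \<le> l"
    and u: "\<And>t. t \<in> T \<Longrightarrow> 0 \<le> u t" "0 \<le> u0" "0 \<le> u1" "u0 + sum u T + u1 = 1"
  shows "B_sup_graph e
    (u0 *\<^sub>R gamma_bar e 0 + (\<Sum>t\<in>T. u t *\<^sub>R gamma_bar e t) + u1 *\<^sub>R gamma_bar e 1)
    (u0 * gamma_last TYPE('n) 0 + (\<Sum>t\<in>T. u t * gamma_last TYPE('n) t) + u1 * gamma_last TYPE('n) 1)"
proof -
  have card: "card T + 2 \<le> Suc l"
    using T(3) by simp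
  obtain y c where y: "y \<in> simplex_ord {2..l}" and c: "\<forall>j\<in>{2..l}. 0 \<le> c j"
    "(\<Sum>j=2..l. c j) = sum u T"
    "(\<Sum>j=2..l. c j *\<^sub>R gamma_bar e (y j)) = (\<Sum>t\<in>T. u t *\<^sub>R gamma_bar e t)"
    "(\<Sum>j=2..l. c j * gamma_last TYPE('n) (y j)) = (\<Sum>t\<in>T. u t * gamma_last TYPE('n) t)"
    by (rule combination_sorted[where f = "gamma_bar e" and g = "gamma_last TYPE('n)",
          OF T(1,2) card u(1)])
  define b where "b = c(1 := u1)"
  have cb: "c j = b j" if "j \<in> {2..l}" for j
    using that by (simp add: b_def)
  have range: "{1..l} = insert 1 {2..l}"
    using T(3) by auto
  have b: "(\<Sum>j=2..l. b j) = sum u T"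
    "(\<Sum>j=2..l. b j *\<^sub>R gamma_bar e (y j)) = (\<Sum>t\<in>T. u t *\<^sub>R gamma_bar e t)"
    "(\<Sum>j=2..l. b j * gamma_last TYPE('n) (y j)) = (\<Sum>t\<in>T. u t * gamma_last TYPE('n) t)"
    unfolding c(2-4)[symmetric] by (simp_all add: cb)
  have b1: "b 1 = u1"
    by (simp add: b_def)
  have sum_b: "(\<Sum>j=1..l. b j) = u1 + sum u T"
    unfolding range by (simp add: b b1[simplified])
  then have u0: "1 - (\<Sum>j=1..l. b j) = u0"
    using u(4) by linarith
  have "b \<in> simplex_c {1..l}"
    unfolding simplex_c_def using c(1) cb u(2) u(3) u0 b1 unfolding range by auto
  from B_sup_graph.odd[OF n this y, of e] show ?thesis
    unfolding u0 b b1 .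
qed

lemma B_inf_graph_evenI:
  fixes e :: "'n::finite \<Rightarrow> nat"
  assumes n: "CARD('n) = 2 * l"
    and T: "finite T" "T \<subseteq> {0..1}" "card T \<le> l"
    and u: "\<And>t. t \<in> T \<Longrightarrow> 0 \<le> u t" "0 \<le> u0" "u0 + sum u T = 1"
  shows "B_inf_graph e (u0 *\<^sub>R gamma_bar e 0 + (\<Sum>t\<in>T. u t *\<^sub>R gamma_bar e t))
    (u0 * gamma_last TYPE('n) 0 + (\<Sum>t\<in>T. u t * gamma_last TYPE('n) t))"
proof -
  have card: "card T + 1 \<le> Suc l"
    using T(3) by simp
  obtain y c where y: "y \<in> simplex_ord {1..l}" and c: "\<forall>j\<in>{1..l}. 0 \<le> c j"
    "(\<Sum>j=1..l. c j) = sum u T"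
    "(\<Sum>j=1..l. c j *\<^sub>R gamma_bar e (y j)) = (\<Sum>t\<in>T. u t *\<^sub>R gamma_bar e t)"
    "(\<Sum>j=1..l. c j * gamma_last TYPE('n) (y j)) = (\<Sum>t\<in>T. u t * gamma_last TYPE('n) t)"
    by (rule combination_sorted[where f = "gamma_bar e" and g = "gamma_last TYPE('n)",
          OF T(1,2) card u(1)])
  have u0: "1 - sum u T = u0"
    using u(3) by linarith
  have "c \<in> simplex_c {1..l}"
    unfolding simplex_c_def using c(1,2) u(2,3) by auto
  from B_inf_graph.even[OF n this y, of e] show ?thesis
    unfolding c(2-4) u0 .
qed

lemma B_inf_graph_oddI:
  fixes e :: "'n::finite \<Rightarrow> nat"
  assumes n: "CARD('n) + 1 = 2 * l"
    and T: "finite T" "T \<subseteq> {0..1}" "card T \<le> l"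
    and u: "\<And>t. t \<in> T \<Longrightarrow> 0 \<le> u t" "sum u T = 1"
  shows "B_inf_graph e (\<Sum>t\<in>T. u t *\<^sub>R gamma_bar e t) (\<Sum>t\<in>T. u t * gamma_last TYPE('n) t)"
proof -
  have card: "card T + 1 \<le> Suc l"
    using T(3) by simp
  obtain y c where y: "y \<in> simplex_ord {1..l}" and c: "\<forall>j\<in>{1..l}. 0 \<le> c j"
    "(\<Sum>j=1..l. c j) = sum u T"
    "(\<Sum>j=1..l. c j *\<^sub>R gamma_bar e (y j)) = (\<Sum>t\<in>T. u t *\<^sub>R gamma_bar e t)"
    "(\<Sum>j=1..l. c j * gamma_last TYPE('n) (y j)) = (\<Sum>t\<in>T. u t * gamma_last TYPE('n) t)"
    by (rule combination_sorted[where f = "gamma_bar e" and g = "gamma_last TYPE('n)",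
          OF T(1,2) card u(1)])
  have range: "{1..l} = insert 1 {2..l}"
    using n by auto
  have c1: "1 - (\<Sum>j=2..l. c j) = c 1"
    using c(2) u(2) unfolding range by simp
  have "c \<in> simplex_c {2..l}"
    unfolding simplex_c_def using c(1)[unfolded range] c1 by auto
  from B_inf_graph.odd[OF n this y, of e] show ?thesis
    unfolding c1 using c(3,4) unfolding range by simp
qed

lemma sum_split_point:
  fixes h :: "'a \<Rightarrow> 'b::comm_monoid_add"
  assumes "finite T"
  shows "sum h T = sum h (T - {a}) + (if a \<in> T then h a else 0)"
  using assms by (auto simp: sum.remove[of T a] add.commute)

lemma sum_split_two_points:
  fixes h :: "'a \<Rightarrow> 'b::comm_monoid_add"
  assumes "finite T" and "a \<noteq> b"
  shows "sum h T =
    (if a \<in> T then h a else 0) + sum h (T - {a, b}) + (if b \<in> T then h b else 0)"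
proof -
  have "T - {a, b} = T - {b} - {a}"
    by auto
  then show ?thesis
    using assms sum_split_point[of T h b] sum_split_point[of "T - {b}" h a]
    by (simp add: add.commute)
qed

text \<open>
  An upper extremal measure has at most \<open>n / 2\<close> nodes, where \<open>1\<close> is not counted and \<open>0\<close> counts one
  half. Rounding gives the shape prescribed for each parity of \<open>n\<close>; for odd \<open>n\<close> the half for the
  node \<open>0\<close> is absorbed by the rounding, so that both endpoints are available for free.
\<close>

lemma B_sup_graph_exists:
  fixes e :: "'n::finite \<Rightarrow> nat"
  assumes e: "bij_betw e UNIV {1..CARD('n)}"
    and x: "x \<in> interior (convex hull (gamma_bar e ` {0..1}))"
  obtains v where "B_sup_graph e x v"
proof -
  obtain T u v q where T: "finite T" "T \<subseteq> {0..1}" and u: "\<forall>t\<in>T. 0 < u t" "sum u T = 1"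
    and xv: "x = (\<Sum>t\<in>T. u t *\<^sub>R gamma_bar e t)" "v = (\<Sum>t\<in>T. u t * gamma_last TYPE('n) t)"
    and q: "degree q = CARD('n) + 1" "1 * lead_coeff q < 0"
      "\<forall>t\<in>{0..1}. 0 \<le> poly q t" "\<forall>t\<in>T. poly q t = 0"
    by (rule extremal_combination[OF e x one_neq_zero])
  have bound: "card (T - {1}) + card (T - {0, 1}) \<le> CARD('n)"
    using sup_nodes_bound[OF T _ q(3,4)[rule_format]] q(1,2) by auto
  define u0 where "u0 = (if 0 \<in> T then u 0 else 0)"
  define u1 where "u1 = (if 1 \<in> T then u 1 else 0)"
  have u01: "0 \<le> u0" "0 \<le> u1"
    using u(1) by (auto simp: u0_def u1_def less_imp_le)
  show thesis
  proof (cases "even (CARD('n))")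
    case True
    then obtain l where l: "CARD('n) = 2 * l"
      by (elim evenE)
    have "card (T - {1}) \<le> card (insert 0 (T - {0, 1}))"
      using T(1) by (intro card_mono) auto
    also have "\<dots> \<le> card (T - {0, 1}) + 1"
      using T(1) by (simp add: card_insert_if)
    finally have "card (T - {1}) \<le> l"
      using bound l by linarith
    then have "B_sup_graph e ((\<Sum>t\<in>T - {1}. u t *\<^sub>R gamma_bar e t) + u1 *\<^sub>R gamma_bar e 1)
        ((\<Sum>t\<in>T - {1}. u t * gamma_last TYPE('n) t) + u1 * gamma_last TYPE('n) 1)"
      using T u u01 sum_split_point[OF T(1), of u 1]
      by (intro B_sup_graph_evenI[OF l]) (auto simp: less_imp_le u1_def)
    moreover have "x = (\<Sum>t\<in>T - {1}. u t *\<^sub>R gamma_bar e t) + u1 *\<^sub>R gamma_bar e 1"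
      unfolding xv u1_def by (subst sum_split_point[OF T(1), of _ 1]) simp
    moreover have "v = (\<Sum>t\<in>T - {1}. u t * gamma_last TYPE('n) t) + u1 * gamma_last TYPE('n) 1"
      unfolding xv u1_def by (subst sum_split_point[OF T(1), of _ 1]) simp
    ultimately show thesis
      using that by simp
  next
    case False
    then have "even (CARD('n) + 1)"
      by simp
    then obtain l where l: "CARD('n) + 1 = 2 * l"
      by (elim evenE)
    have "card (T - {0, 1}) \<le> card (T - {1})"
      using T(1) by (intro card_mono) auto
    then have "card (T - {0, 1}) + 1 \<le> l"
      using bound l by linarith
    moreover have "u0 + sum u (T - {0, 1}) + u1 = 1"
      using u(2) by (simp add: u0_def u1_def sum_split_two_points[OF T(1), of 0 1])
    ultimately have "B_sup_graph e
        (u0 *\<^sub>R gamma_bar e 0 + (\<Sum>t\<in>T - {0, 1}. u t *\<^sub>R gamma_bar e t) + u1 *\<^sub>R gamma_bar e 1)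
        (u0 * gamma_last TYPE('n) 0 + (\<Sum>t\<in>T - {0, 1}. u t * gamma_last TYPE('n) t)
          + u1 * gamma_last TYPE('n) 1)"
      using T u u01 by (intro B_sup_graph_oddI[OF l]) (auto simp: less_imp_le)
    moreover have "x = u0 *\<^sub>R gamma_bar e 0 + (\<Sum>t\<in>T - {0, 1}. u t *\<^sub>R gamma_bar e t)
        + u1 *\<^sub>R gamma_bar e 1"
      unfolding xv u0_def u1_def by (subst sum_split_two_points[OF T(1), of 0 1]) simp_all
    moreover have "v = u0 * gamma_last TYPE('n) 0 + (\<Sum>t\<in>T - {0, 1}. u t * gamma_last TYPE('n) t)
        + u1 * gamma_last TYPE('n) 1"
      unfolding xv u0_def u1_def by (subst sum_split_two_points[OF T(1), of 0 1]) simp_all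
    ultimately show thesis
      using that by simp
  qed
qed

text \<open>
  A lower extremal measure has at most \<open>(n + 1) / 2\<close> nodes, where \<open>0\<close> counts one half. For even \<open>n\<close>
  rounding makes \<open>0\<close> available for free; for odd \<open>n\<close> the node \<open>0\<close> takes a place among the \<open>y\<^sub>j\<close>.
\<close>

lemma B_inf_graph_exists:
  fixes e :: "'n::finite \<Rightarrow> nat"
  assumes e: "bij_betw e UNIV {1..CARD('n)}"
    and x: "x \<in> interior (convex hull (gamma_bar e ` {0..1}))"
  obtains v where "B_inf_graph e x v"
proof -
  have "(- 1 :: real) \<noteq> 0"
    by simp
  then obtain T u v q where T: "finite T" "T \<subseteq> {0..1}" and u: "\<forall>t\<in>T. 0 < u t" "sum u T = 1"
    and xv: "x = (\<Sum>t\<in>T. u t *\<^sub>R gamma_bar e t)" "v = (\<Sum>t\<in>T. u t * gamma_last TYPE('n) t)"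
    and q: "degree q = CARD('n) + 1" "- 1 * lead_coeff q < 0"
      "\<forall>t\<in>{0..1}. 0 \<le> poly q t" "\<forall>t\<in>T. poly q t = 0"
    by (rule extremal_combination[OF e x])
  have bound: "card T + card (T - {0}) \<le> CARD('n) + 1"
    using inf_nodes_bound[OF T _ q(3,4)[rule_format]] q(1,2) by auto
  show thesis
  proof (cases "even (CARD('n))")
    case True
    then obtain l where l: "CARD('n) = 2 * l"
      by (elim evenE)
    define u0 where "u0 = (if 0 \<in> T then u 0 else 0)"
    have "card (T - {0}) \<le> card T"
      using T(1) by (intro card_mono) auto
    then have "card (T - {0}) \<le> l"
      using bound l by linarith
    then have "B_inf_graph e (u0 *\<^sub>R gamma_bar e 0 + (\<Sum>t\<in>T - {0}. u t *\<^sub>R gamma_bar e t))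
        (u0 * gamma_last TYPE('n) 0 + (\<Sum>t\<in>T - {0}. u t * gamma_last TYPE('n) t))"
      using T u sum_split_point[OF T(1), of u 0]
      by (intro B_inf_graph_evenI[OF l]) (auto simp: less_imp_le u0_def)
    moreover have "x = u0 *\<^sub>R gamma_bar e 0 + (\<Sum>t\<in>T - {0}. u t *\<^sub>R gamma_bar e t)"
      unfolding xv u0_def by (subst sum_split_point[OF T(1), of _ 0]) simp
    moreover have "v = u0 * gamma_last TYPE('n) 0 + (\<Sum>t\<in>T - {0}. u t * gamma_last TYPE('n) t)"
      unfolding xv u0_def by (subst sum_split_point[OF T(1), of _ 0]) simp
    ultimately show thesis
      using that by simp
  next
    case False
    then have "even (CARD('n) + 1)"
      by simp
    then obtain l where l: "CARD('n) + 1 = 2 * l"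
      by (elim evenE)
    have "card T \<le> card (T - {0}) + 1"
      using card_Suc_Diff1[OF T(1), of 0] by (cases "0 \<in> T") auto
    then have "card T \<le> l"
      using bound l by linarith
    then have "B_inf_graph e x v"
      unfolding xv using T u by (intro B_inf_graph_oddI[OF l]) (auto simp: less_imp_le)
    then show thesis
      by (rule that)
  qed
qed

section \<open>Roots of the Hankel determinants\<close>

lemma degree_prod_linear: "degree (\<Prod>j\<in>J. [:- y j, 1:]) = card J" for y :: "'a \<Rightarrow> real"
  by (cases "finite J") (simp_all add: degree_prod_eq_sum_degree)

text \<open>
  The weight vanishes at the prescribed endpoints and \<open>\<Prod>(X - y\<^sub>j)\<close> at the other nodes; the number of
  these is below the size of the matrix.
\<close>

lemma hankel_K_eq_0_if_B_sup_graph: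
  fixes e :: "'n::finite \<Rightarrow> nat"
  assumes e: "bij_betw e UNIV {1..CARD('n)}" and "B_sup_graph e x v"
  shows "hankel_K (CARD('n) + 1) (extend_point e x v) = 0"
  using assms(2)
proof cases
  case (even l lam y)
  let ?p = "\<Prod>j\<in>{1..l}. [:- y j, 1:]"
  let ?u = "\<lambda>j. if j = 0 then 1 - (\<Sum>j=1..l. lam j) else lam j"
  let ?t = "\<lambda>j. if j = 0 then 1 else y j"
  have range: "{0..l} = insert 0 {1..l}"
    by auto
  have "Determinant.det (moment_matrix (CARD('n) + 1) [:1, -1:] (l + 1) (extend_point e x v)) = 0"
  proof (rule det_moment_matrix_combination[where A = "{0..l}" and u = ?u and t = ?t and p = ?p, OF e])
    show "degree ?p < l + 1" "?p \<noteq> 0"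
      by (simp_all add: degree_prod_linear)
    show "sum ?u {0..l} = 1"
      unfolding range by simp
    show "x = (\<Sum>j\<in>{0..l}. ?u j *\<^sub>R gamma_bar e (?t j))"
      unfolding even range by (simp add: add.commute)
    show "v = (\<Sum>j\<in>{0..l}. ?u j * gamma_last TYPE('n) (?t j))"
      unfolding even range by (simp add: add.commute)
    show "poly ([:1, -1:] * ?p) (?t j) = 0" if "j \<in> {0..l}" for j
      using that by (auto simp: poly_prod)
  qed (use even(3) in simp)
  then show ?thesis
    using hankel_K_odd[of l] even(3) by simp
next
  case (odd l b y)
  let ?p = "\<Prod>j\<in>{2..l}. [:- y j, 1:]"
  let ?u = "\<lambda>j. if j = 0 then 1 - (\<Sum>j=1..l. b j) else b j"
  let ?t = "\<lambda>j. if j = 0 then 0 else if j = 1 then 1 else y j"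
  have l: "1 \<le> l"
    using odd(3) by simp
  then have range: "{1..l} = insert 1 {2..l}"
    by auto
  have range0: "{0..l} = insert 0 (insert 1 {2..l})"
    using l by auto
  have "Determinant.det (moment_matrix (CARD('n) + 1) [:0, 1, -1:] l (extend_point e x v)) = 0"
  proof (rule det_moment_matrix_combination[where A = "{0..l}" and u = ?u and t = ?t and p = ?p, OF e])
    show "degree ?p < l" "?p \<noteq> 0"
      using l by (simp_all add: degree_prod_linear)
    show "sum ?u {0..l} = 1"
      unfolding range0 range by simp
    show "x = (\<Sum>j\<in>{0..l}. ?u j *\<^sub>R gamma_bar e (?t j))"
      unfolding odd range0 by (simp add: add_ac)
    show "v = (\<Sum>j\<in>{0..l}. ?u j * gamma_last TYPE('n) (?t j))"
      unfolding odd range0 by (simp add: add_ac)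
    show "poly ([:0, 1, -1:] * ?p) (?t j) = 0" if "j \<in> {0..l}" for j
      using that by (auto simp: poly_prod)
  qed (use odd(3) l in simp)
  then show ?thesis
    using hankel_K_even[of l] odd(3) by simp
qed

lemma hankel_S_eq_0_if_B_inf_graph:
  fixes e :: "'n::finite \<Rightarrow> nat"
  assumes e: "bij_betw e UNIV {1..CARD('n)}" and "B_inf_graph e x v"
  shows "hankel_S (CARD('n) + 1) (extend_point e x v) = 0"
  using assms(2)
proof cases
  case (even l lam y)
  let ?p = "\<Prod>j\<in>{1..l}. [:- y j, 1:]"
  let ?u = "\<lambda>j. if j = 0 then 1 - (\<Sum>j=1..l. lam j) else lam j"
  let ?t = "\<lambda>j. if j = 0 then 0 else y j"
  have range: "{0..l} = insert 0 {1..l}"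
    by auto
  have "Determinant.det (moment_matrix (CARD('n) + 1) [:0, 1:] (l + 1) (extend_point e x v)) = 0"
  proof (rule det_moment_matrix_combination[where A = "{0..l}" and u = ?u and t = ?t and p = ?p, OF e])
    show "degree ?p < l + 1" "?p \<noteq> 0"
      by (simp_all add: degree_prod_linear)
    show "sum ?u {0..l} = 1"
      unfolding range by simp
    show "x = (\<Sum>j\<in>{0..l}. ?u j *\<^sub>R gamma_bar e (?t j))"
      unfolding even range by simp
    show "v = (\<Sum>j\<in>{0..l}. ?u j * gamma_last TYPE('n) (?t j))"
      unfolding even range by simp
    show "poly ([:0, 1:] * ?p) (?t j) = 0" if "j \<in> {0..l}" for j
      using that by (auto simp: poly_prod)
  qed (use even(3) in simp)
  then show ?thesis
    using hankel_S_odd[of l] even(3) by simp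
next
  case (odd l b y)
  let ?p = "\<Prod>j\<in>{1..l}. [:- y j, 1:]"
  let ?u = "\<lambda>j. if j = 1 then 1 - (\<Sum>j=2..l. b j) else b j"
  have range: "{1..l} = insert 1 {2..l}"
    using odd(3) by auto
  have "Determinant.det (moment_matrix (CARD('n) + 1) 1 (l + 1) (extend_point e x v)) = 0"
  proof (rule det_moment_matrix_combination[where A = "{1..l}" and u = ?u and t = y and p = ?p, OF e])
    show "degree ?p < l + 1" "?p \<noteq> 0"
      by (simp_all add: degree_prod_linear)
    show "sum ?u {1..l} = 1"
      unfolding range by simp
    show "x = (\<Sum>j\<in>{1..l}. ?u j *\<^sub>R gamma_bar e (y j))"
      unfolding odd range by simp
    show "v = (\<Sum>j\<in>{1..l}. ?u j * gamma_last TYPE('n) (y j))"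
      unfolding odd range by simp
    show "poly (1 * ?p) (y j) = 0" if "j \<in> {1..l}" for j
      using that by (auto simp: poly_prod)
  qed (use odd(3) in simp)
  then show ?thesis
    using hankel_S_even[of l] odd(3) by simp
qed

lemma hankel_K_zero_unique:
  fixes e :: "'n::finite \<Rightarrow> nat"
  assumes e: "bij_betw e UNIV {1..CARD('n)}"
    and x: "x \<in> interior (convex hull (gamma_bar e ` {0..1}))"
    and 0: "hankel_K (CARD('n) + 1) (extend_point e x v) = 0"
      "hankel_K (CARD('n) + 1) (extend_point e x v') = 0"
  shows "v = v'"
proof (cases "even (CARD('n) + 1)")
  case True
  then obtain k where k: "CARD('n) + 1 = 2 * k"
    by (elim evenE)
  then have "0 < k"
    by simp
  have nonneg: "0 \<le> poly [:0, 1, -1:] t" if "t \<in> {0..1}" for t :: real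
  proof -
    have "0 \<le> t * (1 - t)"
      using that by simp
    then show ?thesis
      by (simp add: algebra_simps)
  qed
  have deg: "degree [:0, 1, -1 :: real:] + 2 * (k - 1) = CARD('n) + 1"
    using k \<open>0 < k\<close> by simp
  show ?thesis
    by (rule det_moment_matrix_zero_unique[OF e x _ deg _ 0[unfolded k hankel_K_even, folded k]]) (simp, rule nonneg)
next
  case False
  then obtain k where k: "CARD('n) + 1 = 2 * k + 1"
    by (elim oddE)
  then have deg: "degree [:1, -1 :: real:] + 2 * (k + 1 - 1) = CARD('n) + 1"
    by simp
  show ?thesis
    by (rule det_moment_matrix_zero_unique[OF e x _ deg _ 0[unfolded k hankel_K_odd, folded k]]) simp_all
qed

lemma hankel_S_zero_unique:
  fixes e :: "'n::finite \<Rightarrow> nat"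
  assumes e: "bij_betw e UNIV {1..CARD('n)}"
    and x: "x \<in> interior (convex hull (gamma_bar e ` {0..1}))"
    and 0: "hankel_S (CARD('n) + 1) (extend_point e x v) = 0"
      "hankel_S (CARD('n) + 1) (extend_point e x v') = 0"
  shows "v = v'"
proof (cases "even (CARD('n) + 1)")
  case True
  then obtain k where k: "CARD('n) + 1 = 2 * k"
    by (elim evenE)
  then have deg: "degree (1 :: real poly) + 2 * (k + 1 - 1) = CARD('n) + 1"
    by simp
  show ?thesis
    by (rule det_moment_matrix_zero_unique[OF e x _ deg _ 0[unfolded k hankel_S_even, folded k]]) simp_all
next
  case False
  then obtain k where k: "CARD('n) + 1 = 2 * k + 1"
    by (elim oddE)
  then have deg: "degree [:0, 1 :: real:] + 2 * (k + 1 - 1) = CARD('n) + 1"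
    by simp
  show ?thesis
    by (rule det_moment_matrix_zero_unique[OF e x _ deg _ 0[unfolded k hankel_S_odd, folded k]]) simp_all
qed

theorem corollary2p4:
  fixes e :: "'n::finite \<Rightarrow> nat" and x :: "real ^ 'n"
  assumes "bij_betw e UNIV {1..CARD('n)}"
    and "x \<in> interior (convex hull (gamma_bar e ` {0..1}))"
  shows "(\<forall>v. hankel_K (CARD('n) + 1) (extend_point e x v) = 0 \<longleftrightarrow> v = B_sup e x) \<and>
         (\<forall>v. hankel_S (CARD('n) + 1) (extend_point e x v) = 0 \<longleftrightarrow> v = B_inf e x)"
proof -
  note K = hankel_K_eq_0_if_B_sup_graph[OF assms(1)] hankel_K_zero_unique[OF assms]
  note S = hankel_S_eq_0_if_B_inf_graph[OF assms(1)] hankel_S_zero_unique[OF assms]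
  obtain v where v: "B_sup_graph e x v"
    by (rule B_sup_graph_exists[OF assms])
  then have "B_sup e x = v"
    unfolding B_sup_def using K by (intro the_equality) blast+
  obtain w where w: "B_inf_graph e x w"
    by (rule B_inf_graph_exists[OF assms])
  then have "B_inf e x = w"
    unfolding B_inf_def using S by (intro the_equality) blast+
  show ?thesis
    unfolding \<open>B_sup e x = v\<close> \<open>B_inf e x = w\<close> using v w K S by blast
qed

end
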